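(* Consider a polygon with a fixed ideal triangulation $\Delta$. If $e\in\Delta$ is a diagonal whose adjacent triangles have sides $a,b,e$ and $c,d,e$, with $a,c$ opposite and $b,d$ opposite sides of the quadrilateral formed by these triangles, then the measures of any balanced measured lamination of the polygon are related by $$e=\tfrac12\Bigl\{\max\{a+c,b+d\}+\max\{a+d,b+c\}-\max\{a+b,c+d\}\Bigr\},$$ where an arc is identified with its measure. Furthermore, $a,b,c,d\ge0$ implies $e\ge0$.
   Context: An ideal triangulation of a polygon is a decomposition of it into triangles by diagonals (arcs joining vertices); it is understood to include the frontier edges. A measured lamination of a polygon is described by its measures, real numbers assigned to its frontier edges and diagonals; it is determined by its measures on any one ideal triangulation, and the measures are related by the tropical Ptolemy equation: for any quadrilateral spanned by vertices of the polygon with diagonals $e,f$ and consecutive sides $a,b,c,d$, $e+f=\max\{a+c,b+d\}$. A measured lamination of a polygon is balanced if for each ideal triangulation of the polygon, the tropical triangle inequalities hold on each complementary triangle, i.e. if the triangle has sides $x,y,z$, then $x\le\max\{y,z\}$, $y\le\max\{x,z\}$, $z\le\max\{x,y\}$. *)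

theory Defs
  imports Complex_Main
begin

text \<open>
  The vertices of an \<open>n\<close>-gon are \<open>0, \<dots>, n - 1\<close> in cyclic order. An arc is determined by its two
  endpoints, and is represented by the two-element set of these. The notions below take an arbitrary
  vertex set \<open>V\<close>, standing for the polygon spanned by \<open>V\<close>, so that they apply to the whole polygon
  \<open>{..<n}\<close> as well as to the polygons into which it is cut.
\<close>

definition arcs :: "nat set \<Rightarrow> nat set set" where
  "arcs V = {{p, q} | p q. p \<in> V \<and> q \<in> V \<and> p \<noteq> q}"

text \<open>
  Two vertices are cyclically consecutive in \<open>V\<close> if no vertex of \<open>V\<close> lies strictly between them or
  if they are the first and the last vertex of \<open>V\<close>.
\<close>

definition sides :: "nat set \<Rightarrow> nat set set" where
  "sides V = {{p, q} | p q. p \<in> V \<and> q \<in> V \<and> p < q \<and>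
     ((\<forall>x\<in>V. \<not> (p < x \<and> x < q)) \<or> (\<forall>x\<in>V. p \<le> x \<and> x \<le> q))}"

definition diagonals :: "nat set \<Rightarrow> nat set set" where
  "diagonals V = arcs V - sides V"

definition crossing :: "nat set \<Rightarrow> nat set \<Rightarrow> bool" where
  "crossing x y \<longleftrightarrow> (\<exists>p q r s. p < q \<and> q < r \<and> r < s \<and>
     (x = {p, r} \<and> y = {q, s} \<or> x = {q, s} \<and> y = {p, r}))"

text \<open>
  For a family \<open>\<Delta>\<close> of pairwise non-crossing arcs containing the frontier edges, the complementary
  regions are the polygons bounded by arcs of \<open>\<Delta>\<close> that are not cut further by \<open>\<Delta>\<close>: an arc of \<open>\<Delta>\<close>
  meeting the interior of such a polygon cannot cross its sides, hence would be one of its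
  diagonals. A region is represented by its vertex set.
\<close>

definition complementary_regions :: "nat \<Rightarrow> nat set set \<Rightarrow> nat set set" where
  "complementary_regions n \<Delta> =
     {V. V \<subseteq> {..<n} \<and> 3 \<le> card V \<and> sides V \<subseteq> \<Delta> \<and> diagonals V \<inter> \<Delta> = {}}"

definition ideal_triangulation :: "nat \<Rightarrow> nat set set \<Rightarrow> bool" where
  "ideal_triangulation n \<Delta> \<longleftrightarrow>
     \<Delta> \<subseteq> arcs {..<n} \<and> sides {..<n} \<subseteq> \<Delta> \<and>
     (\<forall>x\<in>\<Delta>. \<forall>y\<in>\<Delta>. \<not> crossing x y) \<and>
     (\<forall>V\<in>complementary_regions n \<Delta>. card V = 3)"

text \<open>
  A measured lamination is given by its measures \<open>\<mu>\<close> on the arcs; the values of \<open>\<mu>\<close> at other sets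
  play no role. The tropical Ptolemy equation is invariant under cyclic relabelling of the
  quadrilateral, so its vertices may be listed in increasing order.
\<close>

definition measured_lamination :: "nat \<Rightarrow> (nat set \<Rightarrow> real) \<Rightarrow> bool" where
  "measured_lamination n \<mu> \<longleftrightarrow>
     (\<forall>p q r s. p < q \<and> q < r \<and> r < s \<and> s < n \<longrightarrow>
        \<mu> {p, r} + \<mu> {q, s} = max (\<mu> {p, q} + \<mu> {r, s}) (\<mu> {q, r} + \<mu> {s, p}))"

definition tropical_triangle :: "real \<Rightarrow> real \<Rightarrow> real \<Rightarrow> bool" where
  "tropical_triangle x y z \<longleftrightarrow> x \<le> max y z \<and> y \<le> max x z \<and> z \<le> max x y"

definition balanced :: "nat \<Rightarrow> (nat set \<Rightarrow> real) \<Rightarrow> bool" where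
  "balanced n \<mu> \<longleftrightarrow>
     (\<forall>\<Delta>. ideal_triangulation n \<Delta> \<longrightarrow>
        (\<forall>T\<in>complementary_regions n \<Delta>. \<forall>x y z.
           sides T = {x, y, z} \<longrightarrow> tropical_triangle (\<mu> x) (\<mu> y) (\<mu> z)))"

end

theory Submission
  imports Defs
begin

text \<open>
  Any triangle spanned by vertices of the polygon is a complementary triangle of some ideal
  triangulation, namely of a maximal non-crossing family of arcs containing its sides. Hence the
  tropical triangle inequalities hold on the two triangles adjacent to \<open>e\<close> and on the two obtained by
  flipping \<open>e\<close> to \<open>f\<close>; together with \<open>e + f = max {a + c, b + d}\<close> they determine \<open>e\<close>.
\<close>

section \<open>Crossing of arcs and sides of a vertex set\<close>

lemma crossing_commute: "crossing x y \<longleftrightarrow> crossing y x"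
  unfolding crossing_def by blast

text \<open>With endpoints listed in increasing order the witnesses in \<open>crossing_def\<close>
  are forced, so crossing becomes a pure order condition.\<close>

lemma crossing_arcs_iff:
  assumes "p < r" "q < s"
  shows "crossing {p, r} {q, s} \<longleftrightarrow> p < q \<and> q < r \<and> r < s \<or> q < p \<and> p < s \<and> s < r"
proof
  assume "crossing {p, r} {q, s}"
  then show "p < q \<and> q < r \<and> r < s \<or> q < p \<and> p < s \<and> s < r"
    unfolding crossing_def using assms by (auto simp: doubleton_eq_iff)
next
  assume "p < q \<and> q < r \<and> r < s \<or> q < p \<and> p < s \<and> s < r"
  then show "crossing {p, r} {q, s}"
    unfolding crossing_def by blast
qed

lemma arcsE:
  assumes "x \<in> arcs V"
  obtains p q where "x = {p, q}" "p \<in> V" "q \<in> V" "p < q"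
proof -
  obtain p q where pq: "x = {p, q}" "p \<in> V" "q \<in> V" "p \<noteq> q"
    using assms unfolding arcs_def by blast
  then have "x = {q, p}"
    by blast
  then show thesis
    using that[of p q] that[of q p] pq by (cases p q rule: linorder_cases) simp_all
qed

lemma sidesE:
  assumes "x \<in> sides V"
  obtains p q where "x = {p, q}" "p \<in> V" "q \<in> V" "p < q"
    "(\<forall>x\<in>V. \<not> (p < x \<and> x < q)) \<or> (\<forall>x\<in>V. p \<le> x \<and> x \<le> q)"
  using assms unfolding sides_def mem_Collect_eq by (elim exE conjE) (rule that)

lemma sides_subset_arcs: "sides V \<subseteq> arcs V"
  unfolding sides_def arcs_def by blast

lemma arcs_mono: "V \<subseteq> W \<Longrightarrow> arcs V \<subseteq> arcs W"
  unfolding arcs_def by blast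

text \<open>A crossing puts one endpoint of \<open>y\<close> strictly between those of
  \<open>x\<close> and the other strictly beyond them. The two alternatives in \<open>sides\<close>
  exclude the former and the latter respectively.\<close>

lemma side_not_crossing_arc:
  assumes "x \<in> sides V" "y \<in> arcs V"
  shows "\<not> crossing x y"
proof -
  obtain p q where x: "x = {p, q}" "p \<in> V" "q \<in> V" "p < q"
    "(\<forall>x\<in>V. \<not> (p < x \<and> x < q)) \<or> (\<forall>x\<in>V. p \<le> x \<and> x \<le> q)"
    using assms(1) by (rule sidesE)
  obtain r s where y: "y = {r, s}" "r \<in> V" "s \<in> V" "r < s"
    using assms(2) by (rule arcsE)
  show ?thesis
    using x y by (auto simp: crossing_arcs_iff)
qed

lemma sides_triangle:
  assumes "p < q" "q < r"
  shows "sides {p, q, r} = {{p, q}, {q, r}, {p, r}}"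
proof
  show "sides {p, q, r} \<subseteq> {{p, q}, {q, r}, {p, r}}"
    using assms by (auto elim!: sidesE)
  have "{p, q} \<in> sides {p, q, r}" "{q, r} \<in> sides {p, q, r}" "{p, r} \<in> sides {p, q, r}"
    unfolding sides_def using assms by force+
  then show "{{p, q}, {q, r}, {p, r}} \<subseteq> sides {p, q, r}"
    by blast
qed

section \<open>Listing vertices in increasing order\<close>

lemma card_gt_nat_obtain_min:
  fixes V :: "nat set"
  assumes "Suc k \<le> card V"
  obtains p where "p \<in> V" "k \<le> card {x \<in> V. p < x}"
proof -
  \<comment> \<open>An infinite set has \<open>card\<close> 0, so a positive cardinality yields both
    facts.\<close>
  have fin: "finite V" and ne: "V \<noteq> {}"
    using assms card.infinite by fastforce+
  have "{x \<in> V. Min V < x} = V - {Min V}"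
    using fin ne by (auto simp: less_le)
  then have "k \<le> card {x \<in> V. Min V < x}"
    using assms fin ne by simp
  then show thesis
    using that Min_in[OF fin ne] by blast
qed

lemma card_ge_3_obtain:
  fixes V :: "nat set"
  assumes "3 \<le> card V"
  obtains p q r where "p \<in> V" "q \<in> V" "r \<in> V" "p < q" "q < r"
proof -
  obtain p where p: "p \<in> V" "2 \<le> card {x \<in> V. p < x}"
    using card_gt_nat_obtain_min[of 2 V] assms by auto
  obtain q where q: "q \<in> V" "p < q" "1 \<le> card {x \<in> {x \<in> V. p < x}. q < x}"
    using card_gt_nat_obtain_min[of 1 "{x \<in> V. p < x}"] p(2) by auto
  obtain r where "r \<in> V" "q < r"
    using card_gt_nat_obtain_min[of 0 "{x \<in> {x \<in> V. p < x}. q < x}"] q(3) by auto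
  then show thesis
    using that p q by blast
qed

lemma card_ge_4_obtain:
  fixes V :: "nat set"
  assumes "4 \<le> card V"
  obtains p q r s where "p \<in> V" "q \<in> V" "r \<in> V" "s \<in> V" "p < q" "q < r" "r < s"
proof -
  obtain p where p: "p \<in> V" "3 \<le> card {x \<in> V. p < x}"
    using card_gt_nat_obtain_min[of 3 V] assms by auto
  obtain q r s where "q \<in> {x \<in> V. p < x}" "r \<in> {x \<in> V. p < x}" "s \<in> {x \<in> V. p < x}"
    "q < r" "r < s"
    using card_ge_3_obtain[OF p(2)] by blast
  then show thesis
    using that p(1) by blast
qed

lemma card_3_obtain:
  fixes V :: "nat set"
  assumes "card V = 3"
  obtains p q r where "V = {p, q, r}" "p < q" "q < r"
proof -
  obtain p q r where pqr: "p \<in> V" "q \<in> V" "r \<in> V" "p < q" "q < r"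
    using card_ge_3_obtain[of V] assms by auto
  have "finite V"
    using assms card.infinite by fastforce
  then have "{p, q, r} = V"
    using pqr assms by (intro card_subset_eq) auto
  then show thesis
    using that pqr by blast
qed

section \<open>Arcs crossing a polygon spanned by vertices\<close>

text \<open>The side joins the neighbours of \<open>u\<close> in \<open>V\<close>: the greatest
  vertex below \<open>u\<close> and the least one above it.\<close>

lemma bounding_side:
  fixes V :: "nat set"
  assumes "finite V" "p \<in> V" "r \<in> V" "p < u" "u < r" "u \<notin> V"
  obtains v w where "{v, w} \<in> sides V" "v < u" "u < w" "\<And>x. x \<in> V \<Longrightarrow> x \<le> v \<or> w \<le> x"
proof -
  define v where "v = Max {x \<in> V. x < u}"
  define w where "w = Min {x \<in> V. u < x}"
  have fin: "finite {x \<in> V. x < u}" "finite {x \<in> V. u < x}"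
    using assms(1) by simp_all
  have "v \<in> {x \<in> V. x < u}"
    unfolding v_def using fin(1) assms by (intro Max_in) auto
  then have v: "v \<in> V" "v < u"
    by simp_all
  have "w \<in> {x \<in> V. u < x}"
    unfolding w_def using fin(2) assms by (intro Min_in) auto
  then have w: "w \<in> V" "u < w"
    by simp_all
  have gap: "x \<le> v \<or> w \<le> x" if "x \<in> V" for x
  proof (cases "x < u")
    case True
    then show ?thesis
      unfolding v_def using fin(1) that by simp
  next
    case False
    then have "u < x"
      using that assms(6) by (metis linorder_neqE_nat)
    then show ?thesis
      unfolding w_def using fin(2) that by simp
  qed
  then have "\<forall>x\<in>V. \<not> (v < x \<and> x < w)"
    using not_le by blast
  moreover have "v < w"
    using v w by simp
  ultimately have "{v, w} \<in> sides V"
    unfolding sides_def using v(1) w(1) by blast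
  then show thesis
    using v(2) w(2) gap by (rule that)
qed

text \<open>The side closing up the polygon; it cuts off the vertices that do not lie between two
  elements of \<open>V\<close>, which \<open>bounding_side\<close> does not reach.\<close>

lemma Min_Max_side:
  fixes V :: "nat set"
  assumes "finite V" "p \<in> V" "r \<in> V" "p < r"
  shows "{Min V, Max V} \<in> sides V"
proof -
  have "Min V \<in> V" "Max V \<in> V"
    using Min_in[OF assms(1)] Max_in[OF assms(1)] assms(2) by blast+
  moreover have "\<forall>x\<in>V. Min V \<le> x \<and> x \<le> Max V"
    using assms(1) by simp
  moreover from this have "Min V < Max V"
    using assms(2-4) by (meson le_less_trans less_le_trans)
  ultimately show ?thesis
    unfolding sides_def by blast
qed

text \<open>
  A vertex \<open>u\<close> outside \<open>V\<close> is cut off from the polygon spanned by \<open>V\<close> by one of its sides, which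
  the arc from \<open>u\<close> to \<open>v\<close> would then have to cross.
\<close>

lemma crossing_endpoint_in_region:
  assumes "finite V" and side: "\<And>x. x \<in> sides V \<Longrightarrow> \<not> crossing x {u, v}"
    and "p \<in> V" "r \<in> V" "p < r"
    and uv: "p < u \<and> u < r \<and> (v < p \<or> r < v) \<or> p < v \<and> v < r \<and> (u < p \<or> r < u)"
  shows "u \<in> V"
proof (rule ccontr)
  assume u: "u \<notin> V"
  have uv_set: "{u, v} = {v, u}"
    by blast
  \<comment> \<open>A side straddling \<open>u\<close> traps \<open>v\<close> in its closed
    interval, as it would otherwise cross the arc. The fact \<open>inside\<close> exchanges the
    roles of \<open>u\<close> and \<open>v\<close>.\<close>
  have outside: "w1 \<le> v \<and> v \<le> w2" if "{w1, w2} \<in> sides V" "w1 < u" "u < w2" for w1 w2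
  proof (rule ccontr)
    assume "\<not> (w1 \<le> v \<and> v \<le> w2)"
    then have "v < w1 \<or> w2 < v"
      by linarith
    then have "crossing {w1, w2} {u, v}"
    proof
      assume "v < w1"
      then show ?thesis
        unfolding uv_set using that by (subst crossing_arcs_iff) auto
    next
      assume "w2 < v"
      then show ?thesis
        using that by (subst crossing_arcs_iff) auto
    qed
    then show False
      using side that(1) by blast
  qed
  have inside: "w1 \<le> u \<and> u \<le> w2" if "{w1, w2} \<in> sides V" "w1 < v" "v < w2" for w1 w2
  proof (rule ccontr)
    assume "\<not> (w1 \<le> u \<and> u \<le> w2)"
    then have "u < w1 \<or> w2 < u"
      by linarith
    then have "crossing {w1, w2} {u, v}"
    proof
      assume "u < w1"
      then show ?thesis
        using that by (subst crossing_arcs_iff) auto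
    next
      assume "w2 < u"
      then show ?thesis
        unfolding uv_set using that by (subst crossing_arcs_iff) auto
    qed
    then show False
      using side that(1) by blast
  qed
  show False
  proof (cases "\<exists>z1\<in>V. \<exists>z2\<in>V. z1 < u \<and> u < z2")
    case True
    then obtain z1 z2 where "z1 \<in> V" "z2 \<in> V" "z1 < u" "u < z2"
      by blast
    then obtain w1 w2 where w: "{w1, w2} \<in> sides V" "w1 < u" "u < w2"
      and gap: "\<And>x. x \<in> V \<Longrightarrow> x \<le> w1 \<or> w2 \<le> x"
      using bounding_side[OF assms(1) _ _ _ _ u] by metis
    \<comment> \<open>Both \<open>u\<close> and \<open>v\<close> lie in the closed interval from
      \<open>w1\<close> to \<open>w2\<close>, while \<open>p\<close> and \<open>r\<close> are not
      strictly inside it, so they cannot separate \<open>u\<close> from \<open>v\<close>.\<close>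
    have "w1 \<le> v \<and> v \<le> w2"
      by (rule outside[OF w])
    then show False
      using gap[OF assms(3)] gap[OF assms(4)] w(2,3) uv by linarith
  next
    case False
    have m: "Min V \<in> V" "Max V \<in> V" "Min V \<le> p" "r \<le> Max V"
      using Min_in[OF assms(1)] Max_in[OF assms(1)] Min_le[OF assms(1,3)] Max_ge[OF assms(1,4)]
        assms(3) by blast+
    \<comment> \<open>As \<open>u\<close> is not between \<open>p\<close> and \<open>r\<close>, it
      is \<open>v\<close> that lies there. The side from \<open>Min V\<close> to
      \<open>Max V\<close> then forces \<open>u\<close> into the range of \<open>V\<close>, against
      the case assumption.\<close>
    have v: "p < v" "v < r"
      using False assms(3,4) uv by blast+
    have "Min V \<le> u \<and> u \<le> Max V"
      by (rule inside[OF Min_Max_side[OF assms(1,3-5)]]) (use m v in linarith)+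
    then have "Min V < u" "u < Max V"
      using m(1,2) u le_neq_implies_less by blast+
    then show False
      using False m(1,2) by blast
  qed
qed

text \<open>Both endpoints of \<open>x\<close> belong to \<open>V\<close> by
  \<open>crossing_endpoint_in_region\<close>, and an arc crossing \<open>d\<close> is not a
  side.\<close>

lemma arc_crossing_region:
  assumes "finite V" and side: "\<And>y. y \<in> sides V \<Longrightarrow> \<not> crossing y x"
    and "d \<in> arcs V" "x \<in> arcs W" "crossing d x"
  shows "x \<in> diagonals V"
proof -
  obtain p r where d: "d = {p, r}" "p \<in> V" "r \<in> V" "p < r"
    using assms(3) by (rule arcsE)
  obtain u v where x: "x = {u, v}" "u < v"
    using assms(4) by (rule arcsE)
  then have x': "x = {v, u}"
    by blast
  have cr: "p < u \<and> u < r \<and> r < v \<or> u < p \<and> p < v \<and> v < r"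
    using assms(5) d x by (simp add: crossing_arcs_iff)
  have "u \<in> V"
    by (rule crossing_endpoint_in_region[OF assms(1) side[unfolded x(1)] d(2-4)]) (use cr in auto)
  moreover have "v \<in> V"
    by (rule crossing_endpoint_in_region[OF assms(1) side[unfolded x'] d(2-4)]) (use cr in auto)
  ultimately have "x \<in> arcs V"
    unfolding arcs_def using x by blast
  moreover have "x \<notin> sides V"
    using side_not_crossing_arc[OF _ assms(3)] assms(5) crossing_commute by blast
  ultimately show ?thesis
    unfolding diagonals_def by blast
qed

section \<open>Completing a triangle to an ideal triangulation\<close>

text \<open>Maximality makes every region a triangle: a region with at least four vertices would
  admit a further diagonal, since an arc of the family crossing it would itself be a diagonal of
  that region.\<close>

lemma triangle_in_ideal_triangulation:
  assumes "T \<subseteq> {..<n}" "card T = 3"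
  obtains \<Delta> where "ideal_triangulation n \<Delta>" "T \<in> complementary_regions n \<Delta>"
proof -
  define C where "C = {\<Delta>. \<Delta> \<subseteq> arcs {..<n} \<and> sides {..<n} \<union> sides T \<subseteq> \<Delta> \<and>
    (\<forall>x\<in>\<Delta>. \<forall>y\<in>\<Delta>. \<not> crossing x y)}"
  have "arcs {..<n} \<subseteq> Pow {..<n}"
    unfolding arcs_def by blast
  then have "finite (arcs {..<n})"
    by (rule finite_subset) simp
  then have "finite C"
    unfolding C_def by (rule rev_finite_subset[OF finite_Pow_iff[THEN iffD2]]) blast
  moreover have "sides {..<n} \<union> sides T \<in> C"
  proof -
    have sub: "sides T \<subseteq> arcs T" "sides T \<subseteq> arcs {..<n}" "sides {..<n} \<subseteq> arcs {..<n}"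
      using sides_subset_arcs arcs_mono[OF assms(1)] by blast+
    \<comment> \<open>Sides of the polygon cross none of its arcs; sides of \<open>T\<close> are
      arcs of \<open>T\<close>, hence do not cross each other.\<close>
    have "\<not> crossing x y" if "x \<in> sides {..<n} \<union> sides T" "y \<in> sides {..<n} \<union> sides T" for x y
      using that sub side_not_crossing_arc crossing_commute by blast
    then show ?thesis
      unfolding C_def using sub by blast
  qed
  ultimately obtain \<Delta> where \<Delta>: "\<Delta> \<in> C" and maximal: "\<And>E. E \<in> C \<Longrightarrow> \<Delta> \<subseteq> E \<Longrightarrow> E = \<Delta>"
    using finite_has_maximal[of C] by auto
  have \<Delta>_arcs: "\<Delta> \<subseteq> arcs {..<n}" and \<Delta>_sides: "sides {..<n} \<subseteq> \<Delta>" "sides T \<subseteq> \<Delta>"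
    and \<Delta>_cross: "\<forall>x\<in>\<Delta>. \<forall>y\<in>\<Delta>. \<not> crossing x y"
    using \<Delta> unfolding C_def by blast+
  have "card V = 3" if V: "V \<in> complementary_regions n \<Delta>" for V
  proof (rule ccontr)
    assume "card V \<noteq> 3"
    have V_n: "V \<subseteq> {..<n}" and V3: "3 \<le> card V" and V_sides: "sides V \<subseteq> \<Delta>"
      and V_diag: "diagonals V \<inter> \<Delta> = {}"
      using V unfolding complementary_regions_def by blast+
    have V_fin: "finite V"
      using V_n finite_subset by blast
    from V3 \<open>card V \<noteq> 3\<close> have "4 \<le> card V"
      by linarith
    then obtain p q r s where pqrs: "p \<in> V" "q \<in> V" "r \<in> V" "s \<in> V" "p < q" "q < r" "r < s"
      by (rule card_ge_4_obtain)
    have arc: "{p, r} \<in> arcs V" "{q, s} \<in> arcs V"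
      unfolding arcs_def using pqrs by force+
    \<comment> \<open>The crossing certifies that \<open>{p, r}\<close> is not a side of
      \<open>V\<close>.\<close>
    have "crossing {p, r} {q, s}"
      using pqrs by (simp add: crossing_arcs_iff)
    then have diag: "{p, r} \<in> diagonals V"
      unfolding diagonals_def using arc side_not_crossing_arc by blast
    have "\<not> crossing {p, r} x" if "x \<in> \<Delta>" for x
    proof
      assume "crossing {p, r} x"
      moreover have "x \<in> arcs {..<n}" "\<And>y. y \<in> sides V \<Longrightarrow> \<not> crossing y x"
        using that V_sides \<Delta>_cross \<Delta>_arcs by blast+
      ultimately have "x \<in> diagonals V"
        using arc_crossing_region[OF V_fin _ arc(1)] by blast
      then show False
        using V_diag that by blast
    qed
    \<comment> \<open>Membership in \<open>C\<close> also compares each arc with itself.\<close>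
    moreover have "\<not> crossing {p, r} {p, r}"
      using pqrs by (simp add: crossing_arcs_iff)
    ultimately have "insert {p, r} \<Delta> \<in> C"
      unfolding C_def using \<Delta>_arcs \<Delta>_sides \<Delta>_cross arc(1) arcs_mono[OF V_n] crossing_commute
      by blast
    then have "{p, r} \<in> \<Delta>"
      using maximal by blast
    then show False
      using diag V_diag by blast
  qed
  then have "ideal_triangulation n \<Delta>"
    unfolding ideal_triangulation_def using \<Delta>_arcs \<Delta>_sides \<Delta>_cross by blast
  moreover have "T \<in> complementary_regions n \<Delta>"
  proof -
    obtain p q r where T: "T = {p, q, r}" "p < q" "q < r"
      using assms(2) by (rule card_3_obtain)
    \<comment> \<open>Every arc between three vertices is a side, so \<open>T\<close> cannot be cut
      further.\<close>
    have "diagonals T = {}"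
      unfolding diagonals_def T(1) sides_triangle[OF T(2,3)] by (auto elim!: arcsE)
    then show ?thesis
      unfolding complementary_regions_def using assms \<Delta>_sides by auto
  qed
  ultimately show thesis
    using that by blast
qed

section \<open>Triangle inequalities and Ptolemy equation for vertices in any order\<close>

lemma tropical_triangle_commute:
  "tropical_triangle x y z \<longleftrightarrow> tropical_triangle y x z"
  "tropical_triangle x y z \<longleftrightarrow> tropical_triangle x z y"
  unfolding tropical_triangle_def by auto

lemma balanced_triangle:
  assumes "balanced n \<mu>" "p < n" "q < n" "r < n" "p \<noteq> q" "q \<noteq> r" "p \<noteq> r"
  shows "tropical_triangle (\<mu> {p, q}) (\<mu> {q, r}) (\<mu> {p, r})"
proof -
  have ordered: "tropical_triangle (\<mu> {p, q}) (\<mu> {q, r}) (\<mu> {p, r})"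
    if "p < q" "q < r" "r < n" for p q r
  proof -
    have "{p, q, r} \<subseteq> {..<n}" "card {p, q, r} = 3"
      using that by auto
    then obtain \<Delta> where "ideal_triangulation n \<Delta>" "{p, q, r} \<in> complementary_regions n \<Delta>"
      by (rule triangle_in_ideal_triangulation)
    then show ?thesis
      using assms(1) sides_triangle[OF that(1,2)] unfolding balanced_def by blast
  qed
  consider "p < q" "q < r" | "p < r" "r < q" | "q < p" "p < r" | "q < r" "r < p"
    | "r < p" "p < q" | "r < q" "q < p"
    using assms(5-7) by linarith
  then show ?thesis
    by cases (use ordered[of p q r] ordered[of p r q] ordered[of q p r] ordered[of q r p]
        ordered[of r p q] ordered[of r q p] assms(2-4)
      in \<open>simp_all add: tropical_triangle_commute insert_commute\<close>)
qed

text \<open>The crossing arcs are the diagonals of a quadrilateral. Relabellings respecting this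
  only permute the two diagonals, or the two pairs of opposite sides, so the equation for sorted
  vertices suffices.\<close>

lemma lamination_crossing:
  assumes "measured_lamination n \<mu>" "crossing {p, r} {q, s}" "p < n" "q < n" "r < n" "s < n"
  shows "\<mu> {p, r} + \<mu> {q, s} = max (\<mu> {p, q} + \<mu> {r, s}) (\<mu> {q, r} + \<mu> {p, s})"
proof -
  obtain p' q' r' s' where less: "p' < q'" "q' < r'" "r' < s'"
    and eq: "{p, r} = {p', r'} \<and> {q, s} = {q', s'} \<or> {p, r} = {q', s'} \<and> {q, s} = {p', r'}"
    using assms(2) unfolding crossing_def by blast
  have "s' < n"
    using eq assms(3-6) by (auto simp: doubleton_eq_iff)
  then have "\<mu> {p', r'} + \<mu> {q', s'} = max (\<mu> {p', q'} + \<mu> {r', s'}) (\<mu> {q', r'} + \<mu> {s', p'})"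
    using assms(1) less unfolding measured_lamination_def by blast
  then show ?thesis
    using eq by (auto simp: doubleton_eq_iff insert_commute add.commute max.commute)
qed

section \<open>Position of the triangles adjacent to a diagonal\<close>

lemma crossing_pairs_iff:
  assumes "p \<noteq> r" "q \<noteq> s"
  shows "crossing {p, r} {q, s} \<longleftrightarrow>
    min p r < min q s \<and> min q s < max p r \<and> max p r < max q s \<or>
    min q s < min p r \<and> min p r < max q s \<and> max q s < max p r"
proof -
  have "{p, r} = {min p r, max p r}" "{q, s} = {min q s, max q s}"
    by (auto simp: min_def max_def)
  moreover have "min p r < max p r" "min q s < max q s"
    using assms by auto
  ultimately show ?thesis
    by (simp only: crossing_arcs_iff)
qed

text \<open>One of the three ways to pair four points on a circle joins alternate points. Excluding
  two pairings thus identifies the diagonals of the quadrilateral.\<close>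

lemma some_pairing_crosses:
  assumes "distinct [p, q, r, s]"
  shows "crossing {p, q} {r, s} \<or> crossing {p, r} {q, s} \<or> crossing {p, s} {q, r}"
proof -
  have "p \<noteq> q" "p \<noteq> r" "p \<noteq> s" "q \<noteq> r" "q \<noteq> s" "r \<noteq> s"
    using assms by auto
  then show ?thesis
    by (cases "p < q"; cases "p < r"; cases "p < s"; cases "q < r"; cases "q < s"; cases "r < s")
      (simp_all add: crossing_pairs_iff min_def max_def)
qed

lemma sides_distinct_triangle:
  assumes "p \<noteq> q" "q \<noteq> r" "p \<noteq> r"
  shows "sides {p, q, r} = {{p, q}, {q, r}, {p, r}}"
proof -
  consider "p < q" "q < r" | "p < r" "r < q" | "q < p" "p < r" | "q < r" "r < p"
    | "r < p" "p < q" | "r < q" "q < p"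
    using assms by linarith
  then show ?thesis
    by cases (use sides_triangle[of p q r] sides_triangle[of p r q] sides_triangle[of q p r]
        sides_triangle[of q r p] sides_triangle[of r p q] sides_triangle[of r q p]
      in \<open>simp_all add: insert_commute\<close>)
qed

text \<open>Serves to match two enumerations of the sides of a triangle that share the side
  \<open>e\<close>.\<close>

lemma triple_eq_cancel:
  assumes "{a, b, e} = {p, q, e}" "p \<noteq> q" "p \<noteq> e" "q \<noteq> e"
  shows "a = p \<and> b = q \<or> a = q \<and> b = p"
proof -
  have "p \<in> {a, b, e}" "q \<in> {a, b, e}"
    unfolding assms(1) by simp_all
  then show ?thesis
    using assms(2-4) by auto
qed

lemma triangle_with_side:
  assumes "card V = 3" "{u, v} \<in> sides V"
  obtains w where "V = {u, w, v}" "u \<noteq> w" "w \<noteq> v" "u \<noteq> v"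
proof -
  have "u \<in> V" "v \<in> V" "u \<noteq> v"
    using assms(2) unfolding sides_def by (auto simp: doubleton_eq_iff)
  moreover from this have "card (V - {u, v}) = 1"
    using assms(1) by (subst card_Diff_subset) auto
  then obtain w where "V - {u, v} = {w}"
    by (rule card_1_singletonE)
  ultimately have "V = {u, w, v}" "u \<noteq> w" "w \<noteq> v" "u \<noteq> v"
    by blast+
  then show thesis
    by (rule that)
qed

section \<open>Solving for the diagonal\<close>

text \<open>In a tropical triangle the maximum is attained at least twice. So if \<open>a\<close>
  and \<open>b\<close> differ, \<open>e\<close> is their maximum, and likewise for \<open>c\<close>
  and \<open>d\<close>; if \<open>a = b\<close> and \<open>c = d\<close>, the equation for
  \<open>e + f\<close> gives \<open>e = min a c\<close>. In each case \<open>e\<close> inherits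
  nonnegativity.\<close>

lemma tropical_flip:
  fixes a b c d e f :: real
  assumes "tropical_triangle a b e" "tropical_triangle c d e"
    and "tropical_triangle b c f" "tropical_triangle a d f"
    and "e + f = max (a + c) (b + d)"
  shows "e = 1 / 2 * (max (a + c) (b + d) + max (a + d) (b + c) - max (a + b) (c + d)) \<and>
    (a \<ge> 0 \<and> b \<ge> 0 \<and> c \<ge> 0 \<and> d \<ge> 0 \<longrightarrow> e \<ge> 0)"
proof -
  \<comment> \<open>The tropical form of Ptolemy's second theorem on the ratio of the diagonals;
    adding the equation for \<open>e + f\<close> yields twice \<open>e\<close>.\<close>
  have "e - f = max (a + d) (b + c) - max (a + b) (c + d)"
    using assms unfolding tropical_triangle_def by (smt (verit))
  moreover have "e \<ge> 0" if "a \<ge> 0" "b \<ge> 0" "c \<ge> 0" "d \<ge> 0"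
    using assms that unfolding tropical_triangle_def by (smt (verit))
  ultimately show ?thesis
    using assms(5) by argo
qed

theorem lemma3p4:
  fixes n :: nat and \<Delta> :: "nat set set" and \<mu> :: "nat set \<Rightarrow> real"
    and a b c d e :: "nat set" and S T :: "nat set"
  assumes "3 \<le> n"
    and "ideal_triangulation n \<Delta>"
    and "e \<in> \<Delta>" and "e \<in> diagonals {..<n}"
    and "S \<in> complementary_regions n \<Delta>" and "T \<in> complementary_regions n \<Delta>" and "S \<noteq> T"
    and "sides S = {a, b, e}" and "sides T = {c, d, e}"
    and "a \<inter> c = {}" and "b \<inter> d = {}"
    and "measured_lamination n \<mu>" and "balanced n \<mu>"
  shows "\<mu> e = 1 / 2 * (max (\<mu> a + \<mu> c) (\<mu> b + \<mu> d) + max (\<mu> a + \<mu> d) (\<mu> b + \<mu> c)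
                        - max (\<mu> a + \<mu> b) (\<mu> c + \<mu> d))
       \<and> (\<mu> a \<ge> 0 \<and> \<mu> b \<ge> 0 \<and> \<mu> c \<ge> 0 \<and> \<mu> d \<ge> 0 \<longrightarrow> \<mu> e \<ge> 0)"
proof -
  have card: "card S = 3" "card T = 3"
    using assms(2,5,6) unfolding ideal_triangulation_def by blast+
  have sub: "S \<subseteq> {..<n}" "T \<subseteq> {..<n}" "sides S \<subseteq> \<Delta>" "sides T \<subseteq> \<Delta>"
    using assms(5,6) unfolding complementary_regions_def by blast+
  have no_cross: "\<not> crossing x y" if "x \<in> \<Delta>" "y \<in> \<Delta>" for x y
    using assms(2) that unfolding ideal_triangulation_def by blast
  obtain u v where e: "e = {u, v}"
    using assms(4) unfolding diagonals_def arcs_def by blast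
  have "{u, v} \<in> sides S" "{u, v} \<in> sides T"
    using assms(8,9) e by simp_all
  then obtain x y where S: "S = {u, x, v}" "u \<noteq> x" "x \<noteq> v" "u \<noteq> v"
    and T: "T = {u, y, v}" "u \<noteq> y" "y \<noteq> v"
    using triangle_with_side[OF card(1)] triangle_with_side[OF card(2)] by metis
  have S_sides: "sides S = {{u, x}, {x, v}, {u, v}}"
    unfolding S(1) using S(2-4) by (rule sides_distinct_triangle)
  have "sides T = {{u, y}, {y, v}, {u, v}}"
    unfolding T(1) using T(2,3) S(4) by (rule sides_distinct_triangle)
  then have T_sides: "sides T = {{u, y}, {v, y}, {u, v}}"
    unfolding insert_commute[of y v] .
  have xy: "x \<noteq> y"
    using S(1) T(1) assms(7) by auto
  have n: "u < n" "v < n" "x < n" "y < n"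
    using S T sub by auto
  have "{u, x} \<in> \<Delta>" "{x, v} \<in> \<Delta>" "{u, y} \<in> \<Delta>" "{v, y} \<in> \<Delta>"
    using sub(3,4) unfolding S_sides T_sides by simp_all
  \<comment> \<open>Two of the three pairings of \<open>u\<close>, \<open>v\<close>,
    \<open>x\<close>, \<open>y\<close> consist of arcs of \<open>\<Delta>\<close>, so only the third
    can cross: \<open>x\<close> and \<open>y\<close> lie on different sides of
    \<open>e\<close>.\<close>
  then have "\<not> crossing {u, x} {v, y}" "\<not> crossing {u, y} {v, x}"
    using no_cross unfolding insert_commute[of v x] by blast+
  then have cross: "crossing {u, v} {x, y}"
    using some_pairing_crosses[of u v x y] S T xy by auto
  note flip = lamination_crossing[OF assms(12) cross n(1,3,2,4)]
  \<comment> \<open>The first two triangles are \<open>S\<close> and \<open>T\<close>; the others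
    arise when \<open>e\<close> is flipped to \<open>{x, y}\<close>.\<close>
  have tri: "tropical_triangle (\<mu> {u, x}) (\<mu> {x, v}) (\<mu> {u, v})"
    "tropical_triangle (\<mu> {v, y}) (\<mu> {u, y}) (\<mu> {u, v})"
    "tropical_triangle (\<mu> {x, v}) (\<mu> {v, y}) (\<mu> {x, y})"
    "tropical_triangle (\<mu> {u, x}) (\<mu> {u, y}) (\<mu> {x, y})"
    using balanced_triangle[OF assms(13), of u x v] balanced_triangle[OF assms(13), of v y u]
      balanced_triangle[OF assms(13), of x v y] balanced_triangle[OF assms(13), of x u y] n S T xy
    by (simp_all add: tropical_triangle_commute insert_commute)
  note formula = tropical_flip[OF tri flip]
  have S_eq: "{a, b, {u, v}} = {{u, x}, {x, v}, {u, v}}"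
    and T_eq: "{c, d, {u, v}} = {{u, y}, {v, y}, {u, v}}"
    using assms(8,9) unfolding e S_sides T_sides by simp_all
  have ab: "a = {u, x} \<and> b = {x, v} \<or> a = {x, v} \<and> b = {u, x}"
    by (rule triple_eq_cancel[OF S_eq]) (use S in \<open>auto simp: doubleton_eq_iff\<close>)
  have cd: "c = {u, y} \<and> d = {v, y} \<or> c = {v, y} \<and> d = {u, y}"
    by (rule triple_eq_cancel[OF T_eq]) (use S T in \<open>auto simp: doubleton_eq_iff\<close>)
  \<comment> \<open>Sides sharing \<open>u\<close> or \<open>v\<close> are not opposite, so
    disjointness of \<open>a\<close> and \<open>c\<close> leaves two of the four labellings.\<close>
  have "{u, x} \<inter> {u, y} \<noteq> {}" "{x, v} \<inter> {v, y} \<noteq> {}"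
    by simp_all
  then have "a = {u, x} \<and> b = {x, v} \<and> c = {v, y} \<and> d = {u, y} \<or>
    a = {x, v} \<and> b = {u, x} \<and> c = {u, y} \<and> d = {v, y}"
    using ab cd assms(10) by metis
  then show ?thesis
  proof (elim disjE conjE)
    assume "a = {u, x}" "b = {x, v}" "c = {v, y}" "d = {u, y}"
    then show ?thesis
      using formula unfolding e by blast
  next
    \<comment> \<open>Exchanging \<open>a\<close> with \<open>b\<close> and \<open>c\<close> with
      \<open>d\<close> leaves all three maxima unchanged.\<close>
    assume "a = {x, v}" "b = {u, x}" "c = {u, y}" "d = {v, y}"
    then show ?thesis
      using formula unfolding e by (simp add: add.commute max.commute)
  qed
qed

end
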